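(* Let $p>3$ be a prime. Then $p$ is a Lerch prime if and only if $$pB_{p-1}\equiv p+(p-1)! \pmod{p^3}.$$
   Context: For an odd prime $p$, the Lerch quotient is the integer $\ell_p=\dfrac{\sum_{a=1}^{p-1}a^{p-1}-p-(p-1)!}{p^2}$, and $p$ is called a Lerch prime if $p\mid \ell_p$, i.e. if $\sum_{a=1}^{p-1}a^{p-1}-p-(p-1)!\equiv 0\pmod{p^3}$. The Bernoulli numbers $B_n$ are the rational numbers defined by $B_0=1$ and, for $n\ge 1$, $\sum_{k=0}^{n}\binom{n+1}{k}B_k=0$ (so $B_1=-1/2$, $B_2=1/6$, $B_3=0$, $B_4=-1/30,\dots$). For rationals, congruences are understood as follows: $a/b\equiv 0\pmod m$ (with $\gcd(a,b)=1$) means $m\mid a$, and $x\equiv y\pmod m$ means $x-y\equiv 0\pmod m$. *)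

theory Defs
  imports Complex_Main "HOL-Number_Theory.Number_Theory"
begin

fun bernoulli :: "nat \<Rightarrow> rat" where
  "bernoulli 0 = 1"
| "bernoulli (Suc n) =
     - (\<Sum>k\<le>n. of_nat ((n + 2) choose k) * bernoulli k) / of_nat (n + 2)"

text \<open>The second equation above is the usual implicit recurrence, solved for the last term.\<close>

lemma bernoulli_recurrence:
  assumes "n \<ge> 1"
  shows "(\<Sum>k\<le>n. of_nat ((n + 1) choose k) * bernoulli k) = 0"
proof -
  obtain m where m: "n = Suc m" using assms by (cases n) auto
  have "(of_nat ((m + 2) choose (Suc m)) :: rat) = of_nat (m + 2)"
    by (metis add_2_eq_Suc' binomial_Suc_n)
  then show ?thesis by (simp add: m field_simps del: of_nat_Suc of_nat_add binomial_Suc_Suc)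
qed

text \<open>Congruence of rationals: the modulus divides the numerator, in lowest terms, of the
  difference. The denominator is not assumed coprime to the modulus: if they share a factor,
  the congruence is false.\<close>

definition rat_cong :: "rat \<Rightarrow> rat \<Rightarrow> int \<Rightarrow> bool" where
  "rat_cong x y m \<longleftrightarrow> m dvd fst (quotient_of (x - y))"

definition lerch_numerator :: "nat \<Rightarrow> int" where
  "lerch_numerator p = (\<Sum>a = 1..p - 1. int a ^ (p - 1)) - int p - fact (p - 1)"

text \<open>The division is exact for odd primes; see \<open>lerch_quotient_exact\<close> below.\<close>

definition lerch_quotient :: "nat \<Rightarrow> int" where
  "lerch_quotient p = lerch_numerator p div (int p)\<^sup>2"

definition lerch_prime :: "nat \<Rightarrow> bool" where
  "lerch_prime p \<longleftrightarrow> prime p \<and> odd p \<and> int p dvd lerch_quotient p"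

lemma cong_prod_one_plus:
  fixes m :: int
  assumes "finite A"
  shows "[(\<Prod>a\<in>A. 1 + m * q a) = 1 + m * (\<Sum>a\<in>A. q a)] (mod m\<^sup>2)"
  using assms
proof (induction A rule: finite_induct)
  case (insert x A)
  have "[(1 + m * q x) * (\<Prod>a\<in>A. 1 + m * q a)
          = (1 + m * q x) * (1 + m * (\<Sum>a\<in>A. q a))] (mod m\<^sup>2)"
    by (rule cong_mult[OF cong_refl insert.IH])
  also have "(1 + m * q x) * (1 + m * (\<Sum>a\<in>A. q a))
      = (1 + m * (q x + (\<Sum>a\<in>A. q a))) + m\<^sup>2 * (q x * (\<Sum>a\<in>A. q a))"
    by (simp add: algebra_simps power2_eq_square)
  also have "[\<dots> = 1 + m * (q x + (\<Sum>a\<in>A. q a))] (mod m\<^sup>2)"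
    by (simp add: cong_iff_dvd_diff)
  finally show ?case using insert by simp
qed simp

lemma square_dvd_lerch_numerator:
  assumes "prime p" "odd p"
  shows "(int p)\<^sup>2 dvd lerch_numerator p"
proof -
  let ?P = "int p" and ?A = "{1..p - 1}"
  have p1: "p > 1" using assms(1) by (rule prime_gt_1_nat)
  have "\<exists>q. int a ^ (p - 1) = 1 + ?P * q" if "a \<in> ?A" for a
  proof -
    have "\<not> p dvd a" using that p1 by (auto dest: dvd_imp_le)
    then have "[a ^ (p - 1) = 1] (mod p)" by (rule fermat_theorem[OF assms(1)])
    then have "[int a ^ (p - 1) = 1] (mod ?P)"
      by (metis cong_int_iff of_nat_1 of_nat_power)
    then have "?P dvd int a ^ (p - 1) - 1" by (simp add: cong_iff_dvd_diff)
    then show ?thesis by (metis dvdE add.commute diff_add_cancel)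
  qed
  then obtain q where q: "\<And>a. a \<in> ?A \<Longrightarrow> int a ^ (p - 1) = 1 + ?P * q a" by metis
  have "[fact (p - 1) = - 1] (mod ?P)"
    using wilson_theorem[OF assms(1)] by simp
  then have "?P dvd fact (p - 1) + 1" by (simp add: cong_iff_dvd_diff)
  then obtain w where w: "fact (p - 1) = ?P * w - 1" by (metis dvdE add_diff_cancel_right')
  have "(fact (p - 1) :: int) ^ (p - 1) = (1 + ?P * (- w)) ^ (p - 1)"
    using power_minus_even[of "p - 1" "1 + ?P * (- w)"] assms(2) unfolding w by simp
  also have "\<dots> = (\<Prod>a\<in>?A. 1 + ?P * (- w))" by simp
  finally have f: "(fact (p - 1) :: int) ^ (p - 1) = (\<Prod>a\<in>?A. 1 + ?P * (- w))" .
  have "(fact (p - 1) :: int) = (\<Prod>a\<in>?A. int a)"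
    by (simp add: fact_prod)
  then have "(fact (p - 1) :: int) ^ (p - 1) = (\<Prod>a\<in>?A. 1 + ?P * q a)"
    using q by (simp add: prod_power_distrib)
  then have "[1 + ?P * (\<Sum>a\<in>?A. q a) = 1 + ?P * (\<Sum>a\<in>?A. - w)] (mod ?P\<^sup>2)"
    using cong_prod_one_plus[of ?A ?P q] cong_prod_one_plus[of ?A ?P "\<lambda>_. - w"] f
    by (simp add: cong_def)
  then have "?P\<^sup>2 dvd ?P * (\<Sum>a\<in>?A. q a) + ?P * (?P - 1) * w"
    using p1 by (simp add: cong_iff_dvd_diff of_nat_diff algebra_simps)
  moreover have "(\<Sum>a\<in>?A. int a ^ (p - 1)) = (\<Sum>a\<in>?A. 1 + ?P * q a)"
    by (rule sum.cong[OF refl q])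
  then have "lerch_numerator p
      = (?P * (\<Sum>a\<in>?A. q a) + ?P * (?P - 1) * w) - ?P\<^sup>2 * w"
    unfolding lerch_numerator_def w using p1
    by (simp add: sum.distrib sum_distrib_left of_nat_diff algebra_simps power2_eq_square)
  ultimately show ?thesis by simp
qed

lemma lerch_quotient_exact:
  assumes "prime p" "odd p"
  shows "(int p)\<^sup>2 * lerch_quotient p = lerch_numerator p"
  using square_dvd_lerch_numerator[OF assms] by (simp add: lerch_quotient_def)

lemma lerch_prime_iff_cong:
  assumes "prime p" "odd p"
  shows "lerch_prime p \<longleftrightarrow>
    [(\<Sum>a = 1..p - 1. int a ^ (p - 1)) - int p - fact (p - 1) = 0] (mod int p ^ 3)"
proof -
  have "int p ^ 3 = (int p)\<^sup>2 * int p" by (simp add: power2_eq_square power3_eq_cube)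
  moreover have "(int p)\<^sup>2 \<noteq> 0" using assms(1) by auto
  ultimately have "int p dvd lerch_quotient p \<longleftrightarrow> int p ^ 3 dvd lerch_numerator p"
    using lerch_quotient_exact[OF assms] by (metis dvd_mult_cancel_left)
  then show ?thesis
    using assms by (simp add: lerch_prime_def lerch_numerator_def cong_0_iff)
qed

end

theory Submission
  imports Defs "HOL-Computational_Algebra.Formal_Power_Series"
begin

text \<open>
  Evaluating Faulhaber's formula for \<open>\<Sum>a<p. a ^ (p - 1)\<close> modulo \<open>p ^ 3\<close> leaves only the
  term \<open>p * B\<^bsub>p-1\<^esub>\<close>: the next term contains \<open>B\<^bsub>p-2\<^esub>\<close>, which vanishes because \<open>p - 2\<close> is odd
  and at least 3, and the remaining terms \<open>(p-1 choose k) * B\<^sub>k * p ^ (p-k) / (p-k)\<close> with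
  \<open>k \<le> p - 3\<close> are \<open>p ^ 3\<close> times a \<open>p\<close>-integral rational, since \<open>p\<close> first enters the
  denominators of the Bernoulli numbers at index \<open>p - 1\<close>.
\<close>

section \<open>The exponential generating function\<close>

definition bernoulli_fps :: "rat fps" where
  "bernoulli_fps = Abs_fps (\<lambda>n. bernoulli n / fact n)"

lemma bernoulli_fps_nth: "fps_nth bernoulli_fps n = bernoulli n / fact n"
  by (simp add: bernoulli_fps_def)

text \<open>Times \<open>fact n\<close>, the coefficient of the product at \<open>n \<ge> 2\<close>
  is the sum that the recurrence makes vanish; at 1 only \<open>bernoulli 0\<close> is left.\<close>

lemma bernoulli_fps_times_exp: "bernoulli_fps * (fps_exp 1 - 1) = fps_X"
proof (rule fps_ext)
  fix n
  show "fps_nth (bernoulli_fps * (fps_exp 1 - 1)) n = fps_nth (fps_X :: rat fps) n"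
  proof (cases n)
    case (Suc m)
    \<comment> \<open>The term \<open>k = Suc m\<close> is absent because
      \<open>fps_exp 1 - 1\<close> has constant term 0.\<close>
    have "fps_nth (bernoulli_fps * (fps_exp 1 - 1)) n
        = (\<Sum>k\<le>m. bernoulli k / fact k * (1 / fact (Suc m - k)))"
      by (simp add: Suc fps_mult_nth bernoulli_fps_nth atLeast0AtMost mult.commute
          del: bernoulli.simps)
    also have "\<dots> = (\<Sum>k\<le>m. of_nat ((m + 1) choose k) * bernoulli k) / fact (Suc m)"
      unfolding sum_divide_distrib
      by (intro sum.cong refl)
         (simp add: binomial_fact field_simps del: fact_Suc binomial_Suc_Suc bernoulli.simps)
    also have "\<dots> = fps_nth (fps_X :: rat fps) n"
      using bernoulli_recurrence[of m] by (cases "m = 0") (auto simp: Suc)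
    finally show ?thesis .
  qed (simp add: bernoulli_fps_nth)
qed

lemma fps_exp_minus_1_neq_0: "fps_exp (1::rat) - 1 \<noteq> 0"
proof
  assume "fps_exp (1::rat) - 1 = 0"
  then have "fps_nth (fps_exp (1::rat) - 1) 1 = 0" by simp
  then show False by simp
qed

text \<open>With B(X) the generating function, B(-X) = X + B(X). At an odd index other than 1 this
  makes a coefficient equal to its own negative.\<close>

lemma bernoulli_odd_eq_0:
  assumes "odd n" "n \<noteq> 1"
  shows "bernoulli n = 0"
proof -
  let ?m = "fps_const (-1) * fps_X :: rat fps"
  let ?B = "bernoulli_fps oo ?m"
  have "?B * (fps_exp (-1) - 1) = (bernoulli_fps * (fps_exp 1 - 1)) oo ?m"
    by (simp add: fps_compose_mult_distrib fps_compose_sub_distrib fps_exp_compose_linear)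
  also have "\<dots> = - fps_X"
    unfolding bernoulli_fps_times_exp by (simp flip: fps_const_neg)
  \<comment> \<open>The factor \<open>fps_exp 1\<close> turns \<open>fps_exp (-1) - 1\<close> into
    \<open>1 - fps_exp 1\<close>, so that a common factor can be cancelled.\<close>
  finally have "?B * ((fps_exp (-1) - 1) * fps_exp 1) = - fps_X * fps_exp 1"
    by (simp only: mult.assoc[symmetric])
  also have "(fps_exp (-1) - 1) * fps_exp 1 = 1 - fps_exp (1::rat)"
    by (simp add: left_diff_distrib flip: fps_exp_add_mult)
  \<comment> \<open>X exp(X) = X (exp(X) - 1) + X, and the last X is
    \<open>bernoulli_fps * (fps_exp 1 - 1)\<close>.\<close>
  finally have "?B * (fps_exp 1 - 1) = (fps_X + bernoulli_fps) * (fps_exp 1 - 1)"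
    using bernoulli_fps_times_exp by (simp add: algebra_simps)
  then have "?B = fps_X + bernoulli_fps"
    using fps_exp_minus_1_neq_0 by simp
  then have "fps_nth ?B n = fps_nth (fps_X + bernoulli_fps) n" by simp
  then show ?thesis
    using assms by (simp add: fps_compose_linear bernoulli_fps_nth del: fps_const_neg)
qed

text \<open>Faulhaber's formula, from the geometric sum of the series exp(aX). Using
  \<open>n choose k\<close> over \<open>Suc n - k\<close> avoids the usual prefactor 1/(n+1), which
  would be 1/p for n = p - 1.\<close>

lemma sum_of_powers_bernoulli:
  "(\<Sum>a<m. of_nat a ^ n) =
     (\<Sum>k\<le>n. of_nat (n choose k) * bernoulli k * (of_nat m ^ (Suc n - k) / of_nat (Suc n - k)))"
proof -
  let ?S = "\<Sum>a<m. fps_exp (of_nat a :: rat)"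
  have "?S * (fps_exp 1 - 1) = fps_exp (of_nat m) - 1"
    by (induction m) (simp_all add: algebra_simps flip: fps_exp_add_mult)
  then have "(bernoulli_fps * (fps_exp 1 - 1)) * ?S = bernoulli_fps * (fps_exp (of_nat m) - 1)"
    by (simp add: mult_ac)
  then have "fps_X * ?S = bernoulli_fps * (fps_exp (of_nat m) - 1)"
    unfolding bernoulli_fps_times_exp .
  \<comment> \<open>The factor \<open>fps_X\<close> shifts the coefficient of \<open>?S\<close> at
    \<open>n\<close> to \<open>Suc n\<close>.\<close>
  then have "fps_nth (fps_X * ?S) (Suc n)
      = fps_nth (bernoulli_fps * (fps_exp (of_nat m) - 1)) (Suc n)"
    by (rule arg_cong)
  then have "(\<Sum>a<m. of_nat a ^ n) / fact n
      = (\<Sum>k\<le>n. bernoulli k / fact k * (of_nat m ^ (Suc n - k) / fact (Suc n - k)))"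
    by (simp add: fps_mult_nth[of bernoulli_fps] fps_sum_nth sum_divide_distrib bernoulli_fps_nth
        atLeast0AtMost mult.commute del: bernoulli.simps fact_Suc)
  then have "(\<Sum>a<m. of_nat a ^ n)
      = (\<Sum>k\<le>n. fact n * (bernoulli k / fact k * (of_nat m ^ (Suc n - k) / fact (Suc n - k))))"
    unfolding sum_distrib_left[symmetric] by (metis fact_nonzero nonzero_eq_divide_eq mult.commute)
  also have "\<dots> = (\<Sum>k\<le>n. of_nat (n choose k) * bernoulli k
      * (of_nat m ^ (Suc n - k) / of_nat (Suc n - k)))"
    by (intro sum.cong refl)
       (simp add: binomial_fact Suc_diff_le field_simps del: bernoulli.simps of_nat_Suc)
  finally show ?thesis .
qed

section \<open>Rationals integral at a prime\<close>

text \<open>For prime \<open>p\<close> this is the localization of the integers at \<open>p\<close>.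
  The fraction need not be reduced, so sums and products are handled by multiplying
  denominators.\<close>

definition p_integral :: "nat \<Rightarrow> rat \<Rightarrow> bool" where
  "p_integral p x \<longleftrightarrow> (\<exists>a b. \<not> int p dvd b \<and> x = of_int a / of_int b)"

lemma p_integral_of_int [simp]:
  assumes "prime p"
  shows "p_integral p (of_int a)"
  unfolding p_integral_def using prime_gt_1_nat[OF assms]
  by (intro exI[of _ a] exI[of _ 1]) auto

lemma p_integral_of_nat [simp]: "prime p \<Longrightarrow> p_integral p (of_nat a)"
  using p_integral_of_int[of p "int a"] by simp

lemma p_integral_add:
  assumes "prime p" "p_integral p x" "p_integral p y"
  shows "p_integral p (x + y)"
proof -
  obtain a b c d where "\<not> int p dvd b" "x = of_int a / of_int b"
      "\<not> int p dvd d" "y = of_int c / of_int d"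
    using assms(2,3) unfolding p_integral_def by blast
  moreover from this have "b \<noteq> 0" "d \<noteq> 0" by auto
  ultimately show ?thesis
    using assms(1) unfolding p_integral_def
    by (intro exI[of _ "a * d + c * b"] exI[of _ "b * d"])
       (auto simp: prime_dvd_mult_iff field_simps)
qed

lemma p_integral_mult:
  assumes "prime p" "p_integral p x" "p_integral p y"
  shows "p_integral p (x * y)"
proof -
  obtain a b c d where "\<not> int p dvd b" "x = of_int a / of_int b"
      "\<not> int p dvd d" "y = of_int c / of_int d"
    using assms(2,3) unfolding p_integral_def by blast
  then show ?thesis
    using assms(1) unfolding p_integral_def
    by (intro exI[of _ "a * c"] exI[of _ "b * d"]) (auto simp: prime_dvd_mult_iff)
qed

lemma p_integral_minus: "p_integral p x \<Longrightarrow> p_integral p (- x)"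
  unfolding p_integral_def by (metis minus_divide_left of_int_minus)

lemma p_integral_sum:
  assumes "prime p" "\<And>i. i \<in> A \<Longrightarrow> p_integral p (f i)"
  shows "p_integral p (\<Sum>i\<in>A. f i)"
  using assms(2) by (induction A rule: infinite_finite_induct)
    (use assms(1) p_integral_of_nat[of p 0] in \<open>auto intro: p_integral_add\<close>)

lemma p_integral_inverse_of_nat: "\<not> p dvd k \<Longrightarrow> p_integral p (1 / of_nat k)"
  unfolding p_integral_def by (intro exI[of _ 1] exI[of _ "int k"]) auto

text \<open>Up to index \<open>n\<close> the recurrence divides only by numbers at most
  \<open>n + 1\<close>, all smaller than \<open>p\<close>.\<close>

lemma p_integral_bernoulli:
  assumes "prime p" "n + 1 < p"
  shows "p_integral p (bernoulli n)"
  using assms(2)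
proof (induction n rule: less_induct)
  case (less n)
  show ?case
  proof (cases n)
    case 0
    then show ?thesis using p_integral_of_nat[OF assms(1), of 1] by simp
  next
    case (Suc m)
    have "p_integral p (\<Sum>k\<le>m. of_nat ((m + 2) choose k) * bernoulli k)"
      using less Suc by (intro p_integral_sum p_integral_mult assms(1) p_integral_of_nat) auto
    moreover have "\<not> p dvd m + 2"
      using less.prems Suc by (auto dest: dvd_imp_le)
    ultimately have "p_integral p (- (\<Sum>k\<le>m. of_nat ((m + 2) choose k) * bernoulli k)
        * (1 / of_nat (m + 2)))"
      by (intro p_integral_mult p_integral_minus p_integral_inverse_of_nat assms(1))
    then show ?thesis by (simp add: Suc)
  qed
qed

text \<open>Replaces lowest terms by a condition that is easy to add and negate. As
  \<open>e > 0\<close>, a divisible numerator keeps \<open>p\<close> out of the coprime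
  denominator.\<close>

lemma prime_power_dvd_numerator_iff:
  assumes "prime p" "e > 0"
  shows "int p ^ e dvd fst (quotient_of z) \<longleftrightarrow> (\<exists>w. p_integral p w \<and> z = of_nat p ^ e * w)"
proof -
  obtain a b where ab: "quotient_of z = (a, b)" by fastforce
  have z: "z = of_int a / of_int b" and b: "b > 0" and cop: "coprime a b"
    using ab by (auto simp: quotient_of_div quotient_of_denom_pos quotient_of_coprime)
  have pi: "prime (int p)" using assms(1) by simp
  show ?thesis
  proof
    assume "int p ^ e dvd fst (quotient_of z)"
    then obtain c where c: "a = int p ^ e * c" using ab by (auto elim: dvdE)
    have "int p dvd a" using c assms(2) by (simp add: dvd_power)
    then have "\<not> int p dvd b"
      using cop pi by (metis coprime_common_divisor not_prime_unit)
    moreover have "z = of_nat p ^ e * (of_int c / of_int b)" by (simp add: z c)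
    ultimately show "\<exists>w. p_integral p w \<and> z = of_nat p ^ e * w"
      unfolding p_integral_def by blast
  next
    assume "\<exists>w. p_integral p w \<and> z = of_nat p ^ e * w"
    then obtain c d where cd: "\<not> int p dvd d" "z = of_nat p ^ e * (of_int c / of_int d)"
      unfolding p_integral_def by blast
    have "d \<noteq> 0" using cd(1) by auto
    then have "(of_int (a * d) :: rat) = of_int (int p ^ e * c * b)"
      using cd(2) z b by (simp add: field_simps)
    then have "a * d = int p ^ e * c * b" by (simp only: of_int_eq_iff)
    then have "int p ^ e dvd a * d" by simp
    moreover have "coprime (int p ^ e) d"
      using pi cd(1) by (simp add: prime_imp_coprime)
    ultimately show "int p ^ e dvd fst (quotient_of z)"
      using ab by (simp add: coprime_dvd_mult_left_iff)
  qed
qed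

lemma rat_cong_prime_power_iff:
  assumes "prime p" "e > 0"
  shows "rat_cong x y (int p ^ e) \<longleftrightarrow> (\<exists>w. p_integral p w \<and> x - y = of_nat p ^ e * w)"
  unfolding rat_cong_def by (rule prime_power_dvd_numerator_iff[OF assms])

lemma rat_cong_of_int_iff: "rat_cong (of_int a) (of_int b) m \<longleftrightarrow> [a = b] (mod m)"
  by (simp add: rat_cong_def cong_iff_dvd_diff flip: of_int_diff)

lemma rat_cong_sym:
  assumes "rat_cong x y (int p ^ e)" "prime p" "e > 0"
  shows "rat_cong y x (int p ^ e)"
proof -
  obtain w where w: "p_integral p w" "x - y = of_nat p ^ e * w"
    using assms by (auto simp: rat_cong_prime_power_iff)
  then have "y - x = of_nat p ^ e * - w" by (simp add: algebra_simps)
  with w(1) show ?thesis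
    unfolding rat_cong_prime_power_iff[OF assms(2,3)] by (blast intro: p_integral_minus)
qed

lemma rat_cong_trans:
  assumes "rat_cong x y (int p ^ e)" "rat_cong y z (int p ^ e)" "prime p" "e > 0"
  shows "rat_cong x z (int p ^ e)"
proof -
  obtain v w where vw: "p_integral p v" "x - y = of_nat p ^ e * v"
      "p_integral p w" "y - z = of_nat p ^ e * w"
    using assms by (auto simp: rat_cong_prime_power_iff)
  then have "x - z = of_nat p ^ e * (v + w)" by (simp add: algebra_simps)
  with vw(1,3) show ?thesis
    unfolding rat_cong_prime_power_iff[OF assms(3,4)] by (blast intro: p_integral_add assms(3))
qed

section \<open>The power sum modulo the cube of a prime\<close>

text \<open>For \<open>j < p\<close> the divisor is a unit at \<open>p\<close>. For
  \<open>j = p\<close> it costs one factor \<open>p\<close>, and \<open>p - 1 \<ge> 3\<close>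
  factors remain.\<close>

lemma p_integral_prime_power_div:
  assumes "prime p" "p > 3" "3 \<le> j" "j \<le> p"
  shows "\<exists>w. p_integral p w \<and> (of_nat p ^ j / of_nat j :: rat) = of_nat p ^ 3 * w"
proof (cases "j = p")
  case True
  have "(of_nat p ^ j :: rat) = of_nat p * (of_nat p ^ 3 * of_nat p ^ (p - 4))"
    using assms(2) True by (simp flip: power_add power_Suc)
  then have "(of_nat p ^ j / of_nat j :: rat) = of_nat p ^ 3 * of_nat (p ^ (p - 4))"
    using assms(2) True by simp
  then show ?thesis using p_integral_of_nat[OF assms(1)] by blast
next
  case False
  then have "\<not> p dvd j" using assms by (auto dest: dvd_imp_le)
  then have "p_integral p (of_nat (p ^ (j - 3)) * (1 / of_nat j))"
    by (intro p_integral_mult p_integral_inverse_of_nat p_integral_of_nat assms(1))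
  moreover have "(of_nat p ^ j / of_nat j :: rat)
      = of_nat p ^ 3 * (of_nat (p ^ (j - 3)) * (1 / of_nat j))"
    using assms(3) by (simp flip: power_add)
  ultimately show ?thesis by blast
qed

text \<open>Congruence to an integer also shows that \<open>of_nat p * bernoulli (p - 1)\<close> is
  p-integral, so von Staudt-Clausen is not called upon.\<close>

lemma power_sum_cong_bernoulli:
  assumes "prime p" "p > 3"
  shows "rat_cong (of_int (\<Sum>a = 1..p - 1. int a ^ (p - 1))) (of_nat p * bernoulli (p - 1))
    (int p ^ 3)"
proof -
  define t where "t k = of_nat ((p - 1) choose k) * bernoulli k
    * (of_nat p ^ (p - k) / of_nat (p - k))" for k
  have "\<exists>w. p_integral p w \<and> t k = of_nat p ^ 3 * w" if k: "k \<le> p - 3" for k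
  proof -
    have "3 \<le> p - k" using k assms(2) by simp
    then obtain v where v: "p_integral p v"
        "(of_nat p ^ (p - k) / of_nat (p - k) :: rat) = of_nat p ^ 3 * v"
      using p_integral_prime_power_div[OF assms _ diff_le_self] by blast
    have "p_integral p (of_nat ((p - 1) choose k) * bernoulli k * v)"
      using k assms v(1)
      by (intro p_integral_mult p_integral_of_nat p_integral_bernoulli) auto
    moreover have "t k = of_nat p ^ 3 * (of_nat ((p - 1) choose k) * bernoulli k * v)"
      unfolding t_def v(2) by simp
    ultimately show ?thesis by blast
  qed
  then obtain w where w: "\<And>k. k \<le> p - 3 \<Longrightarrow> p_integral p (w k)"
      "\<And>k. k \<le> p - 3 \<Longrightarrow> t k = of_nat p ^ 3 * w k"
    by metis
  have "odd (p - 2)" using assms prime_odd_nat[of p] by simp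
  then have t2: "t (p - 2) = 0"
    using bernoulli_odd_eq_0[of "p - 2"] assms(2) by (simp add: t_def)
  \<comment> \<open>The added term at 0 vanishes since the exponent \<open>p - 1\<close> is
    positive.\<close>
  have "of_int (\<Sum>a = 1..p - 1. int a ^ (p - 1)) = (\<Sum>a<p. (of_nat a ^ (p - 1) :: rat))"
  proof -
    have "{..<p} = insert 0 {1..p - 1}" using assms(2) by auto
    then show ?thesis using assms(2) by simp
  qed
  also have "\<dots> = (\<Sum>k\<le>p - 1. t k)"
    using sum_of_powers_bernoulli[of "p - 1" p] assms(2) by (simp add: t_def)
  also have "{..p - 1} = insert (p - 1) (insert (p - 2) {..p - 3})" using assms(2) by auto
  also have "sum t \<dots> = t (p - 1) + (t (p - 2) + (\<Sum>k\<le>p - 3. t k))"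
    using assms(2) by (subst sum.insert; force)+
  \<comment> \<open>At \<open>k = p - 1\<close> the binomial coefficient, the divisor and the
    exponent of \<open>p\<close> are all 1.\<close>
  also have "\<dots> = of_nat p * bernoulli (p - 1) + (\<Sum>k\<le>p - 3. t k)"
    using t2 assms(2) by (simp add: t_def)
  also have "(\<Sum>k\<le>p - 3. t k) = of_nat p ^ 3 * (\<Sum>k\<le>p - 3. w k)"
    using w(2) by (simp add: sum_distrib_left)
  finally show ?thesis
    using p_integral_sum[OF assms(1), of "{..p - 3}" w] w(1)
    by (subst rat_cong_prime_power_iff[OF assms(1)]) auto
qed

theorem theorem1:
  fixes p :: nat
  assumes "prime p" and "p > 3"
  shows "lerch_prime p \<longleftrightarrow>
    rat_cong (of_nat p * bernoulli (p - 1)) (of_nat p + fact (p - 1)) (int p ^ 3)"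
proof -
  let ?S = "\<Sum>a = 1..p - 1. int a ^ (p - 1)"
  have "odd p" using assms prime_odd_nat[of p] by simp
  then have "lerch_prime p \<longleftrightarrow> [?S = int p + fact (p - 1)] (mod int p ^ 3)"
    using lerch_prime_iff_cong[OF assms(1)]
    by (simp add: cong_iff_dvd_diff algebra_simps)
  also have "\<dots> \<longleftrightarrow> rat_cong (of_int ?S) (of_int (int p + fact (p - 1))) (int p ^ 3)"
    by (rule rat_cong_of_int_iff[symmetric])
  \<comment> \<open>Both directions exchange \<open>?S\<close> for the Bernoulli term, to which it
    is congruent, by symmetry and transitivity.\<close>
  also have "\<dots> \<longleftrightarrow>
      rat_cong (of_nat p * bernoulli (p - 1)) (of_int (int p + fact (p - 1))) (int p ^ 3)"
    using power_sum_cong_bernoulli[OF assms] assms(1) rat_cong_sym rat_cong_trans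
    by (metis zero_less_numeral)
  finally show ?thesis by simp
qed

end
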